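(* Let $G$ be a finite group of odd order. Then $G$ has a Lee metric if and only if $G$ is cyclic.
   Context: All metrics on groups are integral (integer valued) and right translation invariant: $d(gh,g'h)=d(g,g')$ for all $g,g',h\in G$. The weight of $d$ is $w(x)=d(x,e)$, $e$ the identity of $G$. The partition induced by $d$, denoted $P(G,d)$, is the set of classes of the equivalence relation $g\sim h\Leftrightarrow w(g)=w(h)$. An interval metric is such a metric $d$ with finitely many weights and without gaps: if $P(G,d)$ has $n$ parts different from $\{e\}$, then the set of values of $w$ is exactly $\{0,1,\ldots,n\}$. The Lee partition of $G$ is $\mathcal{P}_{Lee}(G)=\{\{a,a^{-1}\}:a\in G\}$. A Lee metric on $G$ is an interval metric $d$ on $G$ with $P(G,d)=\mathcal{P}_{Lee}(G)$. *)

theory Defs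
  imports "HOL-Algebra.Elementary_Groups" "HOL-Analysis.Abstract_Metric_Spaces"
begin

text \<open>
  Only the values of \<open>d\<close> on \<open>carrier G\<close> matter; the library locale \<open>Metric_space\<close>
  additionally requires non-negativity and symmetry outside the carrier.
\<close>
definition group_metric :: "('a, 'b) monoid_scheme \<Rightarrow> ('a \<Rightarrow> 'a \<Rightarrow> int) \<Rightarrow> bool" where
  "group_metric G d \<longleftrightarrow>
     Metric_space (carrier G) (\<lambda>x y. real_of_int (d x y)) \<and>
     (\<forall>g \<in> carrier G. \<forall>g' \<in> carrier G. \<forall>h \<in> carrier G.
        d (g \<otimes>\<^bsub>G\<^esub> h) (g' \<otimes>\<^bsub>G\<^esub> h) = d g g')"

definition weight :: "('a, 'b) monoid_scheme \<Rightarrow> ('a \<Rightarrow> 'a \<Rightarrow> int) \<Rightarrow> 'a \<Rightarrow> int" where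
  "weight G d x = d x \<one>\<^bsub>G\<^esub>"

definition weight_rel :: "('a, 'b) monoid_scheme \<Rightarrow> ('a \<Rightarrow> 'a \<Rightarrow> int) \<Rightarrow> ('a \<times> 'a) set" where
  "weight_rel G d =
     {(g, h). g \<in> carrier G \<and> h \<in> carrier G \<and> weight G d g = weight G d h}"

definition induced_partition ::
    "('a, 'b) monoid_scheme \<Rightarrow> ('a \<Rightarrow> 'a \<Rightarrow> int) \<Rightarrow> 'a set set" where
  "induced_partition G d = carrier G // weight_rel G d"

definition interval_metric :: "('a, 'b) monoid_scheme \<Rightarrow> ('a \<Rightarrow> 'a \<Rightarrow> int) \<Rightarrow> bool" where
  "interval_metric G d \<longleftrightarrow>
     group_metric G d \<and>
     finite (weight G d ` carrier G) \<and>
     weight G d ` carrier G = {0..int (card (induced_partition G d - {{\<one>\<^bsub>G\<^esub>}}))}"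

definition lee_partition :: "('a, 'b) monoid_scheme \<Rightarrow> 'a set set" where
  "lee_partition G = {{a, inv\<^bsub>G\<^esub> a} | a. a \<in> carrier G}"

definition lee_metric :: "('a, 'b) monoid_scheme \<Rightarrow> ('a \<Rightarrow> 'a \<Rightarrow> int) \<Rightarrow> bool" where
  "lee_metric G d \<longleftrightarrow>
     interval_metric G d \<and> induced_partition G d = lee_partition G"

end

theory Submission
  imports Defs "HOL-Algebra.Multiplicative_Group"
begin

text \<open>
  Weights are subadditive. Given a Lee metric with maximal weight \<open>n\<close> on a nontrivial group, let
  \<open>a\<close> have weight 1 and \<open>H = \<langle>a\<rangle>\<close> have order \<open>2r + 1\<close>; then weights on \<open>H\<close> are at most \<open>r\<close>.
  Every ball of radius \<open>t\<close> has at most \<open>2t + 1\<close> elements, so if \<open>r \<ge> n\<close> then \<open>H = G\<close>.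
  Otherwise an element \<open>b\<close> of weight \<open>r + 1\<close> lies outside \<open>H\<close>, and the cosets \<open>H\<close>, \<open>Hb\<close>,
  \<open>Hb\<inverse>\<close> are disjoint, since \<open>b\<^sup>2 \<in> H\<close> would give \<open>b \<in> H\<close> by oddness. They all lie in the ball
  of radius \<open>2r + 1\<close>, whence \<open>3(2r + 1) \<le> 4r + 3\<close> and \<open>r = 0\<close>, contradicting \<open>a \<noteq> e\<close>.
  Conversely, the word length with respect to a generator of a cyclic group is the weight of a
  Lee metric.
\<close>

context group
begin

section \<open>Weights of right-invariant metrics\<close>

lemma weight_nonneg:
  assumes "group_metric G d"
  shows "0 \<le> weight G d x"
proof -
  interpret Metric_space "carrier G" "\<lambda>x y. real_of_int (d x y)"
    using assms by (simp add: group_metric_def)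
  have "0 \<le> real_of_int (d x \<one>)"
    by (rule nonneg)
  then show ?thesis
    by (simp add: weight_def)
qed

lemma weight_eq_0_iff:
  assumes "group_metric G d" "x \<in> carrier G"
  shows "weight G d x = 0 \<longleftrightarrow> x = \<one>"
proof -
  interpret Metric_space "carrier G" "\<lambda>x y. real_of_int (d x y)"
    using assms by (simp add: group_metric_def)
  have "real_of_int (d x \<one>) = 0 \<longleftrightarrow> x = \<one>"
    using assms by (intro zero) auto
  then show ?thesis
    by (simp add: weight_def)
qed

lemma weight_one: "group_metric G d \<Longrightarrow> weight G d \<one> = 0"
  by (simp add: weight_eq_0_iff)

text \<open>Right translation by \<open>x\<close> carries the pair \<open>inv x\<close>,
  \<open>\<one>\<close> to \<open>\<one>\<close>, \<open>x\<close>; symmetry of \<open>d\<close>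
  does the rest.\<close>

lemma weight_inv:
  assumes "group_metric G d" "x \<in> carrier G"
  shows "weight G d (inv x) = weight G d x"
proof -
  interpret Metric_space "carrier G" "\<lambda>x y. real_of_int (d x y)"
    using assms by (simp add: group_metric_def)
  have "d (inv x \<otimes> x) (\<one> \<otimes> x) = d (inv x) \<one>"
    using assms unfolding group_metric_def by blast
  then have "weight G d (inv x) = d \<one> x"
    using assms by (simp add: weight_def)
  then show ?thesis
    using commute[of x \<one>] by (simp add: weight_def)
qed

text \<open>The triangle inequality through \<open>y\<close>: right translation by \<open>y\<close>
  shows that \<open>x \<otimes> y\<close> lies at distance \<open>weight G d x\<close> from
  \<open>y\<close>.\<close>

lemma weight_mult_le:
  assumes "group_metric G d" "x \<in> carrier G" "y \<in> carrier G"
  shows "weight G d (x \<otimes> y) \<le> weight G d x + weight G d y"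
proof -
  interpret Metric_space "carrier G" "\<lambda>x y. real_of_int (d x y)"
    using assms by (simp add: group_metric_def)
  have "d (x \<otimes> y) (\<one> \<otimes> y) = d x \<one>"
    using assms unfolding group_metric_def by blast
  moreover have "d (x \<otimes> y) \<one> \<le> d (x \<otimes> y) y + d y \<one>"
    using triangle[of "x \<otimes> y" y \<one>] assms by simp
  ultimately show ?thesis
    using assms by (simp add: weight_def)
qed

lemma weight_pow_le:
  fixes k :: nat
  assumes "group_metric G d" "x \<in> carrier G"
  shows "weight G d (x [^] k) \<le> int k * weight G d x"
proof (induction k)
  case 0
  then show ?case using weight_one assms by simp
next
  case (Suc k)
  have "weight G d (x [^] k \<otimes> x) \<le> weight G d (x [^] k) + weight G d x"
    using weight_mult_le assms by simp
  with Suc show ?case by (simp add: algebra_simps)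
qed

section \<open>Counting weight classes and balls\<close>

lemma induced_partition_eq:
  "induced_partition G d =
    (\<lambda>i. {x \<in> carrier G. weight G d x = i}) ` weight G d ` carrier G"
proof -
  have "weight_rel G d `` {x} = {y \<in> carrier G. weight G d y = weight G d x}"
    if "x \<in> carrier G" for x
    using that by (auto simp: weight_rel_def)
  then show ?thesis
    by (auto simp: induced_partition_def quotient_def image_image)
qed

text \<open>Parts correspond bijectively to weights, and \<open>{\<one>}\<close> is the part of
  weight 0. So the absence of gaps can be checked on the set of weights alone.\<close>

lemma card_induced_partition:
  assumes "group_metric G d" and "finite (weight G d ` carrier G)"
  shows "card (induced_partition G d - {{\<one>}}) = card (weight G d ` carrier G) - 1"
proof -
  let ?C = "\<lambda>i. {x \<in> carrier G. weight G d x = i}"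
  let ?W = "weight G d ` carrier G"
  have inj: "inj_on ?C ?W"
    by (auto simp: inj_on_def)
  have 0: "?C 0 = {\<one>}"
    using weight_eq_0_iff[OF assms(1)] by auto
  have "0 \<in> ?W"
    using weight_one[OF assms(1)] by (metis imageI one_closed)
  then have "{\<one>} \<in> induced_partition G d"
    unfolding induced_partition_eq 0[symmetric] by (rule imageI)
  then have "card (induced_partition G d - {{\<one>}}) = card (induced_partition G d) - 1"
    by (rule card_Diff_singleton)
  then show ?thesis
    using inj unfolding induced_partition_eq by (simp only: card_image)
qed

text \<open>Weight 0 contributes only the identity. Each further weight contributes nothing or a Lee
  class \<open>{a, inv a}\<close>, hence at most two elements.\<close>

lemma lee_metric_card_ball_le:
  assumes "lee_metric G d" "finite (carrier G)"
  shows "card {x \<in> carrier G. weight G d x \<le> int t} \<le> 2 * t + 1"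
proof (induction t)
  have gm: "group_metric G d"
    using assms by (simp add: lee_metric_def interval_metric_def)
  {
    case 0
    have "{x \<in> carrier G. weight G d x \<le> int 0} \<subseteq> {\<one>}"
      using weight_eq_0_iff[OF gm] weight_nonneg[OF gm] by (auto intro: order_antisym)
    from card_mono[OF _ this] show ?case by simp
  next
    case (Suc t)
    let ?C = "{x \<in> carrier G. weight G d x = int (Suc t)}"
    have C: "card ?C \<le> 2"
    proof (cases "?C = {}")
      case True
      then show ?thesis by (simp only: card.empty)
    next
      case False
      then obtain x where "x \<in> carrier G" "weight G d x = int (Suc t)"
        by blast
      then have "int (Suc t) \<in> weight G d ` carrier G"
        by (metis imageI)
      then have "?C \<in> induced_partition G d"
        unfolding induced_partition_eq by (rule imageI)
      then have "?C \<in> lee_partition G"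
        using assms by (simp add: lee_metric_def)
      then obtain a where "?C = {a, inv a}"
        unfolding lee_partition_def by blast
      then show ?thesis
        by (simp add: card_insert_if)
    qed
    have "{x \<in> carrier G. weight G d x \<le> int (Suc t)} =
        {x \<in> carrier G. weight G d x \<le> int t} \<union> ?C"
      by auto
    then have "card {x \<in> carrier G. weight G d x \<le> int (Suc t)} \<le>
        card {x \<in> carrier G. weight G d x \<le> int t} + card ?C"
      by (simp only: card_Un_le)
    from order_trans[OF this add_mono[OF Suc C]] show ?case by simp
  }
qed

section \<open>A Lee metric forces cyclicity in odd order\<close>

text \<open>In a group of order \<open>2 * k + 1\<close>, every \<open>b\<close> is a power of its
  own square, namely the one with exponent \<open>k + 1\<close>.\<close>

lemma square_mem_subgroup_odd:
  assumes "odd (order G)" "subgroup H G" "b \<in> carrier G" "b \<otimes> b \<in> H"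
  shows "b \<in> H"
proof -
  obtain k where k: "order G = 2 * k + 1"
    using assms(1) by (elim oddE)
  have "(b \<otimes> b) [^] (Suc k) = b [^] (2 * Suc k)"
    using assms(3) nat_pow_pow[of b 2 "Suc k"] by (simp add: numeral_2_eq_2)
  also have "2 * Suc k = order G + 1"
    using k by simp
  also have "b [^] (order G + 1) = b"
    using assms(3) pow_order_eq_1[of b] by (simp add: nat_pow_mult[symmetric])
  finally have "b = (b \<otimes> b) [^] (Suc k)" ..
  moreover have "(b \<otimes> b) [^] (Suc k) \<in> H"
    using subgroup_int_pow_closed[OF assms(2,4), of "int (Suc k)"] unfolding int_pow_int .
  ultimately show ?thesis by simp
qed

lemma lee_metric_imp_cyclic:
  assumes lee: "lee_metric G d" and fin: "finite (carrier G)" and odd: "odd (order G)"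
  shows "cyclic_group G"
proof (cases "carrier G = {\<one>}")
  case True
  then show ?thesis
    by (intro trivial_imp_cyclic_group) (simp add: trivial_group_def)
next
  case False
  let ?w = "weight G d"
  have gm: "group_metric G d"
    using lee by (simp add: lee_metric_def interval_metric_def)
  obtain n :: nat where n: "?w ` carrier G = {0..int n}"
    using lee unfolding lee_metric_def interval_metric_def by blast
  obtain x where x: "x \<in> carrier G" "x \<noteq> \<one>"
    using False by blast
  \<comment> \<open>A nonidentity element has positive weight, so \<open>n\<close> is at least 1; as
    there are no gaps, weight 1 is attained.\<close>
  have "?w x \<in> {0..int n}"
    using x n by blast
  moreover have "?w x \<noteq> 0"
    using weight_eq_0_iff[OF gm] x by simp
  ultimately have "1 \<in> {0..int n}"
    by auto
  then obtain a where a: "a \<in> carrier G" "?w a = 1"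
    using n by (metis (no_types, lifting) imageE)
  let ?H = "generate G {a}"
  have H: "subgroup ?H G"
    using a by (simp add: generate_is_subgroup)
  have HG: "?H \<subseteq> carrier G"
    using H subgroup.subset by blast
  have cardH: "card ?H = ord a"
    using generate_pow_card[OF a(1)] by simp
  have "ord a dvd order G"
    using ord_dvd_group_order[OF a(1)] .
  with odd have "odd (ord a)"
    using dvd_trans by blast
  then obtain r where r: "ord a = 2 * r + 1"
    by (elim oddE)
  have "a \<noteq> \<one>"
    using a weight_one[OF gm] by auto
  then have "r \<noteq> 0"
    using r ord_eq_1[OF a(1)] by auto
  have wH: "?w h \<le> int r" if "h \<in> ?H" for h
  proof -
    have "?H = {a [^] k |k. k \<in> {0..ord a - 1}}"
      using r ord_elems_inf_carrier[OF a(1)] generate_pow_nat[OF a(1)] by simp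
    with that r obtain k where k: "h = a [^] k" "k < ord a"
      by auto
    show ?thesis
    proof (cases "k \<le> r")
      case True
      then show ?thesis
        using weight_pow_le[OF gm a(1), of k] a k by simp
    next
      case False
      \<comment> \<open>For \<open>k > r\<close> the shorter way round the cycle is through the
        inverse: \<open>ord a - k\<close> is at most \<open>r\<close>.\<close>
      have "a [^] k \<otimes> a [^] (ord a - k) = \<one>"
        using k a by (simp add: nat_pow_mult)
      then have "h = inv (a [^] (ord a - k))"
        using k a by (simp add: inv_equality)
      then have "?w h = ?w (a [^] (ord a - k))"
        using weight_inv[OF gm] a by simp
      also have "\<dots> \<le> int (ord a - k)"
        using weight_pow_le[OF gm a(1), of "ord a - k"] a by simp
      finally show ?thesis
        using False r by linarith
    qed
  qed
  show ?thesis
  proof (cases "n \<le> r")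
    case True
    have "{x \<in> carrier G. ?w x \<le> int n} = carrier G"
      using n by auto
    \<comment> \<open>The ball of radius \<open>n\<close> is the whole group, so its order is at
      most \<open>2 * n + 1\<close>, hence at most \<open>2 * r + 1\<close>, the order of
      \<open>?H\<close>.\<close>
    then have "card (carrier G) \<le> card ?H"
      using lee_metric_card_ball_le[OF lee fin, of n] True r cardH by simp
    then have "?H = carrier G"
      using card_seteq[OF fin HG] by blast
    then show ?thesis
      using a generate_pow[OF a(1)] by (auto simp: cyclic_group full_SetCompr_eq)
  next
    case False
    then have "int r + 1 \<in> {0..int n}"
      by simp
    then obtain b where b: "b \<in> carrier G" "?w b = int r + 1"
      using n by (metis (no_types, lifting) imageE)
    have "b \<notin> ?H"
      using wH b by fastforce
    have "inv b \<notin> ?H"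
      using wH[of "inv b"] weight_inv[OF gm b(1)] b by linarith
    have neq: "?H \<noteq> ?H #> b" "?H \<noteq> ?H #> inv b"
      using coset_join1[OF _ _ H] b \<open>b \<notin> ?H\<close> \<open>inv b \<notin> ?H\<close> by (metis inv_closed)+
    have neq': "?H #> b \<noteq> ?H #> inv b"
    proof
      assume "?H #> b = ?H #> inv b"
      then have "b \<in> ?H #> inv b"
        using rcos_self[OF b(1) H] by simp
      then obtain h where h: "h \<in> ?H" "b = h \<otimes> inv b"
        by (auto simp: r_coset_def)
      then have "b \<otimes> b = h"
        using HG b by (metis inv_closed inv_solve_right subsetD)
      then show False
        using square_mem_subgroup_odd[OF odd H b(1)] h \<open>b \<notin> ?H\<close> by simp
    qed
    have "?H \<in> rcosets ?H"
      using rcosetsI[OF HG one_closed] coset_mult_one[OF HG] by simp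
    then have cosets: "?H \<in> rcosets ?H" "?H #> b \<in> rcosets ?H" "?H #> inv b \<in> rcosets ?H"
      using rcosetsI[OF HG] b by simp_all
    have finH: "finite ?H" "finite (?H #> b)" "finite (?H #> inv b)"
      using fin HG b by (auto intro: finite_subset r_coset_subset_G[THEN finite_subset])
    have disj: "?H \<inter> (?H #> b) = {}" "(?H \<union> (?H #> b)) \<inter> (?H #> inv b) = {}"
      using pairwiseD[OF rcos_disjoint[OF H]] cosets neq neq' by (auto simp: disjnt_def)
    have "card (?H \<union> (?H #> b) \<union> (?H #> inv b)) = card ?H + card (?H #> b) + card (?H #> inv b)"
      using finH disj by (simp only: card_Un_disjoint finite_Un simp_thms)
    then have card3: "card (?H \<union> (?H #> b) \<union> (?H #> inv b)) = 3 * card ?H"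
      using cosets(2,3)[THEN card_rcosets_equal[OF _ HG]] by linarith
    have sub: "?H \<union> (?H #> b) \<union> (?H #> inv b) \<subseteq>
        {x \<in> carrier G. ?w x \<le> int (2 * r + 1)}"
    proof -
      \<comment> \<open>Weight at most \<open>r\<close> from the factor in \<open>?H\<close>, plus
        \<open>r + 1\<close> from \<open>b\<close> or \<open>inv b\<close>.\<close>
      have "?w (h \<otimes> c) \<le> int (2 * r + 1)" if "h \<in> ?H" "c \<in> {b, inv b}" for h c
      proof -
        have "?w c = int r + 1"
          using that b weight_inv[OF gm] by auto
        then show ?thesis
          using weight_mult_le[OF gm, of h c] wH[OF that(1)] that HG b by fastforce
      qed
      moreover have "?w h \<le> int (2 * r + 1)" if "h \<in> ?H" for h
        using wH[OF that] by linarith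
      ultimately show ?thesis
        using HG b by (auto simp: r_coset_def)
    qed
    have "finite {x \<in> carrier G. ?w x \<le> int (2 * r + 1)}"
      using fin by simp
    from card_mono[OF this sub]
    have "3 * card ?H \<le> card {x \<in> carrier G. ?w x \<le> int (2 * r + 1)}"
      unfolding card3 .
    also have "\<dots> \<le> 2 * (2 * r + 1) + 1"
      using lee_metric_card_ball_le[OF lee fin] .
    finally show ?thesis
      using cardH r \<open>r \<noteq> 0\<close> by simp
  qed
qed

section \<open>Word length in a cyclic group\<close>

text \<open>The word length over the letters \<open>a\<close> and \<open>inv a\<close>. It is
  meaningful only for powers of \<open>a\<close>; elsewhere \<open>LEAST\<close> ranges over an
  empty set.\<close>

definition cyclic_length :: "'a \<Rightarrow> 'a \<Rightarrow> nat" where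
  "cyclic_length a x = (LEAST n. \<exists>k::int. nat \<bar>k\<bar> = n \<and> a [^] k = x)"

lemma cyclic_length_le:
  "cyclic_length a (a [^] (k::int)) \<le> nat \<bar>k\<bar>"
  unfolding cyclic_length_def by (rule Least_le) blast

lemma cyclic_length_attained:
  assumes "x \<in> range (\<lambda>k::int. a [^] k)"
  obtains k :: int where "nat \<bar>k\<bar> = cyclic_length a x" "a [^] k = x"
proof -
  have "\<exists>n. \<exists>k::int. nat \<bar>k\<bar> = n \<and> a [^] k = x"
    using assms by auto
  from LeastI_ex[OF this] show ?thesis
    using that unfolding cyclic_length_def by blast
qed

lemma cyclic_imp_lee_metric:
  assumes cyc: "cyclic_group G" and fin: "finite (carrier G)"
  shows "\<exists>d. lee_metric G d"
proof -
  obtain a where a: "a \<in> carrier G" and G: "carrier G = range (\<lambda>k::int. a [^] k)"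
    using cyc unfolding cyclic_group by blast
  let ?l = "cyclic_length a"
  have att: "\<exists>k::int. nat \<bar>k\<bar> = ?l x \<and> a [^] k = x" if "x \<in> carrier G" for x
    using cyclic_length_attained that unfolding G by blast
  have inv_cancel: "x \<otimes> (inv x \<otimes> y) = y" "inv x \<otimes> (x \<otimes> y) = y"
    if "x \<in> carrier G" "y \<in> carrier G" for x y
    using that by (simp_all flip: m_assoc)
  have l_one: "?l \<one> = 0"
    using cyclic_length_le[of a 0] unfolding int_pow_0 by simp
  have l_0: "x = \<one>" if x: "x \<in> carrier G" "?l x = 0" for x
  proof -
    obtain k :: int where "nat \<bar>k\<bar> = 0" "a [^] k = x"
      using att[OF x(1)] unfolding x(2) by blast
    then show ?thesis by simp
  qed
  have l_inv_le: "?l (inv x) \<le> ?l x" if x: "x \<in> carrier G" for x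
  proof -
    obtain k :: int where "nat \<bar>k\<bar> = ?l x" "a [^] k = x"
      using att[OF x] by blast
    then show ?thesis
      using cyclic_length_le[of a "- k"] a by (simp add: int_pow_neg)
  qed
  then have l_inv: "?l (inv x) = ?l x" if "x \<in> carrier G" for x
    using that by (metis inv_closed inv_inv order_antisym)
  have l_mult: "?l (x \<otimes> y) \<le> ?l x + ?l y" if xy: "x \<in> carrier G" "y \<in> carrier G" for x y
  proof -
    obtain i j :: int where "nat \<bar>i\<bar> = ?l x" "a [^] i = x" "nat \<bar>j\<bar> = ?l y" "a [^] j = y"
      using att xy by metis
    then show ?thesis
      using cyclic_length_le[of a "i + j"] a by (simp add: int_pow_mult)
  qed
  have l_eq: "?l y = ?l x \<longleftrightarrow> y = x \<or> y = inv x"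
    if xy: "x \<in> carrier G" "y \<in> carrier G" for x y
  proof
    obtain i j :: int where ij: "nat \<bar>i\<bar> = ?l x" "a [^] i = x" "nat \<bar>j\<bar> = ?l y" "a [^] j = y"
      using att xy by metis
    assume "?l y = ?l x"
    \<comment> \<open>The shortest exponents have the same absolute value, so they agree up to
      sign.\<close>
    then have "j = i \<or> j = - i"
      using ij by linarith
    then show "y = x \<or> y = inv x"
      using ij int_pow_neg[OF a] by auto
  qed (use l_inv xy in auto)
  have l_down: "\<exists>y \<in> carrier G. ?l y = n" if x: "x \<in> carrier G" "?l x = Suc n" for x n
  proof -
    obtain k :: int where k: "nat \<bar>k\<bar> = Suc n" "a [^] k = x"
      using att[OF x(1)] unfolding x(2) by blast
    \<comment> \<open>\<open>a [^] s\<close> is one letter of a shortest word for \<open>x\<close>.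
      Removing it leaves length at most \<open>n\<close>, and by subadditivity at least
      \<open>n\<close>.\<close>
    define s where "s = sgn k"
    have "a [^] (k - s) \<otimes> a [^] s = x"
      using k a by (simp flip: int_pow_mult)
    then have "?l x \<le> ?l (a [^] (k - s)) + ?l (a [^] s)"
      using l_mult a by (metis int_pow_closed)
    moreover have "?l (a [^] s) \<le> 1"
      using cyclic_length_le[of a s] by (auto simp: s_def sgn_if split: if_splits)
    moreover have "?l (a [^] (k - s)) \<le> n"
      using cyclic_length_le[of a "k - s"] k(1) by (auto simp: s_def sgn_if split: if_splits)
    ultimately have "?l (a [^] (k - s)) = n"
      using x by linarith
    then show ?thesis
      using a by blast
  qed

  \<comment> \<open>Depending only on \<open>x \<otimes> inv y\<close> makes \<open>d\<close> right
    invariant. The value 0 off the carrier secures the non-negativity and symmetry that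
    \<open>Metric_space\<close> demands there.\<close>
  define d where
    "d x y = (if x \<in> carrier G \<and> y \<in> carrier G then int (?l (x \<otimes> inv y)) else 0)" for x y
  have w: "weight G d x = int (?l x)" if "x \<in> carrier G" for x
    using that by (simp add: weight_def d_def)
  have d_sym: "d x y = d y x" for x y
    using l_inv[of "x \<otimes> inv y"] by (auto simp: d_def inv_mult_group)
  have gm: "group_metric G d"
    unfolding group_metric_def
  proof (intro conjI ballI)
    show "Metric_space (carrier G) (\<lambda>x y. real_of_int (d x y))"
    proof
      fix x y z
      show "0 \<le> real_of_int (d x y)"
        by (simp add: d_def)
      show "real_of_int (d x y) = real_of_int (d y x)"
        using d_sym by simp
      assume xy: "x \<in> carrier G" "y \<in> carrier G"
      show "real_of_int (d x y) = 0 \<longleftrightarrow> x = y"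
        using l_0[of "x \<otimes> inv y"] xy l_one by (auto simp: d_def right_cancel inv_solve_right')
      assume z: "z \<in> carrier G"
      \<comment> \<open>This telescoping turns subadditivity of the length into the triangle
        inequality.\<close>
      have "(x \<otimes> inv y) \<otimes> (y \<otimes> inv z) = x \<otimes> inv z"
        using xy z by (simp add: m_assoc inv_cancel)
      then show "real_of_int (d x z) \<le> real_of_int (d x y) + real_of_int (d y z)"
        using l_mult[of "x \<otimes> inv y" "y \<otimes> inv z"] xy z by (simp add: d_def)
    qed
  next
    fix g g' h
    assume h: "g \<in> carrier G" "g' \<in> carrier G" "h \<in> carrier G"
    then have "(g \<otimes> h) \<otimes> inv (g' \<otimes> h) = g \<otimes> inv g'"
      by (simp add: inv_mult_group m_assoc inv_cancel)
    then show "d (g \<otimes> h) (g' \<otimes> h) = d g g'"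
      using h by (simp add: d_def)
  qed
  define N where "N = Max (?l ` carrier G)"
  have "N \<in> ?l ` carrier G"
    unfolding N_def using fin by (intro Max_in) auto
  \<comment> \<open>Downward induction from the maximal length \<open>N\<close>, with
    \<open>l_down\<close> as the step.\<close>
  have "m \<in> ?l ` carrier G" if "m \<le> N" for m
    using that \<open>N \<in> ?l ` carrier G\<close>
  proof (induction rule: inc_induct)
    case (step m)
    then obtain x where "x \<in> carrier G" "?l x = Suc m"
      by force
    from l_down[OF this] show ?case
      by force
  qed
  then have "?l ` carrier G = {0..N}"
    using fin by (auto simp: N_def)
  moreover have "weight G d ` carrier G = int ` ?l ` carrier G"
    using w by (simp add: image_image)
  ultimately have W: "weight G d ` carrier G = {0..int N}"
    by (simp add: image_int_atLeastAtMost)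
  \<comment> \<open>There are \<open>N + 1\<close> weights, and discarding the class of the identity
    leaves \<open>N\<close> parts.\<close>
  then have "card (induced_partition G d - {{\<one>}}) = N"
    using card_induced_partition[OF gm] by simp
  then have "interval_metric G d"
    using gm W by (simp add: interval_metric_def)
  moreover have "{y \<in> carrier G. weight G d y = weight G d x} = {x, inv x}"
    if "x \<in> carrier G" for x
    using l_eq[OF that] that by (auto simp: w l_inv)
  then have "induced_partition G d = lee_partition G"
    unfolding induced_partition_eq lee_partition_def by (auto simp: image_image image_iff)
  ultimately show ?thesis
    unfolding lee_metric_def by blast
qed

end

theorem theorem3p3:
  fixes G :: "('a, 'b) monoid_scheme"
  assumes "group G" and "finite (carrier G)" and "odd (order G)"
  shows "(\<exists>d. lee_metric G d) \<longleftrightarrow> cyclic_group G"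
  using group.lee_metric_imp_cyclic[OF assms(1) _ assms(2,3)]
    group.cyclic_imp_lee_metric[OF assms(1) _ assms(2)] by blast

end
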